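(* Let $q\in\mathbb{C}$ with $0<|q|<1$. Define $$\Omega_1 := \frac{f(q^{4}, q^{6})}{f(-q, -q^{9})}, \qquad \Omega_2 := q\,\frac{f(q^2, q^{8})}{f(-q^3, -q^{7})}.$$ Then $$\frac{1}{\Omega_1^2}+\frac{1}{\Omega_2^2} = \frac{\varphi^4(-q)}{16q^4\psi^4(-q^5)} + \frac{\varphi^4(-q^5)}{16q^4\psi^4(-q^5)} - \frac{\varphi^2(-q)\varphi^2(-q^5)}{8q^4\psi^4(-q^5)} + \frac{2\varphi(-q)\psi(q^5)}{q\,\varphi(-q^{10})\psi(-q)}.$$
   Context: For $|rs|<1$, Ramanujan's general theta function is $f(r,s)=\sum_{n=-\infty}^{\infty} r^{n(n+1)/2}s^{n(n-1)/2}$. Also $\varphi(q)=f(q,q)=\sum_{n=-\infty}^{\infty}q^{n^2}$ and $\psi(q)=f(q,q^3)=\sum_{n\ge0}q^{n(n+1)/2}$. *)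

theory Defs
  imports "HOL-Analysis.Analysis"
begin

(* Both exponents are nonnegative integers and the divisions by 2 are exact; the sum converges
   absolutely for norm (r * s) < 1, the only range in which it is meant to be used. *)
definition ramanujan_f :: "complex \<Rightarrow> complex \<Rightarrow> complex" where
  "ramanujan_f r s =
     (\<Sum>\<^sub>\<infinity>n\<in>(UNIV::int set). r powi (n * (n + 1) div 2) * s powi (n * (n - 1) div 2))"

definition ramanujan_phi :: "complex \<Rightarrow> complex" where
  "ramanujan_phi q = ramanujan_f q q"

definition ramanujan_psi :: "complex \<Rightarrow> complex" where
  "ramanujan_psi q = ramanujan_f q (q ^ 3)"

end

theory Submission
  imports Defs
begin

text \<open>Put \<open>t = - q\<close> and \<open>a = f(t^4,t^6)\<close>, \<open>b = f(t^2,t^8)\<close>, \<open>c = f(t,t^9)\<close>, \<open>d = f(t^3,t^7)\<close>, so that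
  \<open>X = c / a = 1 / \<Omega>\<^sub>1\<close> and \<open>Y = d / (t b) = - 1 / \<Omega>\<^sub>2\<close>, and write \<open>X^2 + Y^2 = (X + Y)^2 - 2 X Y\<close>.
  The product \<open>X Y\<close> is evaluated by the Jacobi triple product and gives the last term of the claim.
  For the sum, \<open>a d + t b c = f(t,t^4) f(t^2,t^3)\<close>, which by the triple product equals
  \<open>a b c d / \<psi>(t^5)^2\<close>; hence \<open>X + Y = c d / (t \<psi>(t^5)^2)\<close>, and Ramanujan's identity
  \<open>\<phi>(t)^2 - \<phi>(t^5)^2 = 4 t c d\<close> turns the square of this into the first three terms.
  The triple product also shows that none of the theta functions in a denominator vanishes.\<close>

section \<open>The Jacobi triple product\<close>

text \<open>This is the q-Pochhammer symbol (-x; p)_infinity. The sign makes \<open>r\<close> and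
  \<open>s\<close> themselves the arguments in the triple product, and the factor (p; p)_infinity
  becomes \<open>qprod (- p) p\<close>.\<close>

definition qprod :: "complex \<Rightarrow> complex \<Rightarrow> complex" where
  "qprod x p = (\<Prod>n. 1 + x * p ^ n)"

definition theta_term :: "complex \<Rightarrow> complex \<Rightarrow> int \<Rightarrow> complex" where
  "theta_term r s n = r powi (n * (n + 1) div 2) * s powi (n * (n - 1) div 2)"

section \<open>Convergence, non-vanishing and regrouping of the infinite products\<close>

lemma norm_mult_power_less_1:
  fixes x p :: complex
  assumes "norm p < 1" "norm x < 1"
  shows "norm (x * p ^ n) < 1"
proof -
  have "norm p ^ n \<le> 1"
    using assms by (simp add: power_le_one)
  hence "norm x * norm p ^ n \<le> norm x"
    by (simp add: mult_left_le)
  thus ?thesis using assms by (simp add: norm_mult norm_power)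
qed

lemma norm_power_less_1:
  fixes t :: complex
  assumes "norm t < 1" "n > 0"
  shows "norm (t ^ n) < 1"
  using assms by (simp add: norm_power power_less_one_iff)

lemma one_plus_mult_power_nonzero:
  fixes x p :: complex
  assumes "norm p < 1" "norm x < 1"
  shows "1 + x * p ^ n \<noteq> 0"
proof
  assume "1 + x * p ^ n = 0"
  hence "x * p ^ n = -1" by (simp add: eq_neg_iff_add_eq_0 add.commute)
  thus False using norm_mult_power_less_1[OF assms, of n] by simp
qed

lemma convergent_prod_qprod:
  fixes x p :: complex
  assumes "norm p < 1" "norm x < 1"
  shows "convergent_prod (\<lambda>n. 1 + x * p ^ n)"
proof (rule summable_imp_convergent_prod_complex)
  show "summable (\<lambda>k. norm (x * p ^ k))"
    using assms by (simp add: norm_mult norm_power)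
  show "x * p ^ k \<noteq> -1" for k
    using one_plus_mult_power_nonzero[OF assms, of k] by (metis add.right_inverse)
qed

lemma qprod_nonzero:
  assumes "norm p < 1" "norm x < 1"
  shows "qprod x p \<noteq> 0"
  unfolding qprod_def
  by (intro prodinf_nonzero convergent_prod_qprod one_plus_mult_power_nonzero assms)

lemma qprod_LIMSEQ:
  assumes "norm p < 1" "norm x < 1"
  shows "(\<lambda>N. \<Prod>n<N. 1 + x * p ^ n) \<longlonglongrightarrow> qprod x p"
  using convergent_prod_LIMSEQ[OF convergent_prod_qprod[OF assms]]
  unfolding qprod_def lessThan_Suc_atMost[symmetric] by (rule LIMSEQ_imp_Suc)

lemma qprod_mult_neg:
  assumes "norm p < 1" "norm x < 1"
  shows "qprod x p * qprod (- x) p = qprod (- (x ^ 2)) (p ^ 2)"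
proof -
  have "(1 + x * p ^ n) * (1 + (- x) * p ^ n) = 1 + (- (x ^ 2)) * (p ^ 2) ^ n" for n
    by (simp add: power_mult [symmetric] algebra_simps power2_eq_square
        flip: power_add mult_2)
  moreover have "convergent_prod (\<lambda>n. 1 + (- x) * p ^ n)"
    by (rule convergent_prod_qprod) (use assms in auto)
  ultimately show ?thesis
    unfolding qprod_def using convergent_prod_qprod[OF assms]
    by (simp only: prodinf_mult)
qed

text \<open>Sort the factors by the residue \<open>j\<close> of the index modulo \<open>k\<close>.
  The prefixes of length \<open>N * k\<close> form a subsequence of the partial products and regroup
  exactly into \<open>k\<close> prefixes of length \<open>N\<close>, so both sides are limits of the
  same sequence.\<close>

lemma qprod_split:
  assumes "norm p < 1" "norm x < 1" "k > 0"
  shows "qprod x p = (\<Prod>j<k. qprod (x * p ^ j) (p ^ k))"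
proof (rule LIMSEQ_unique)
  have pk: "norm (p ^ k) < 1"
    by (rule norm_power_less_1) (use assms in auto)
  show "(\<lambda>N. \<Prod>j<k. \<Prod>n<N. 1 + (x * p ^ j) * (p ^ k) ^ n) \<longlonglongrightarrow> (\<Prod>j<k. qprod (x * p ^ j) (p ^ k))"
    by (intro tendsto_prod qprod_LIMSEQ pk norm_mult_power_less_1 assms)
  have "strict_mono (\<lambda>N. N * k)"
    using assms by (simp add: strict_mono_def)
  from LIMSEQ_subseq_LIMSEQ[OF qprod_LIMSEQ[OF assms(1,2)] this]
  have "(\<lambda>N. \<Prod>n<N * k. 1 + x * p ^ n) \<longlonglongrightarrow> qprod x p"
    by (simp add: o_def)
  also have "(\<lambda>N. \<Prod>n<N * k. 1 + x * p ^ n) = (\<lambda>N. \<Prod>j<k. \<Prod>n<N. 1 + (x * p ^ j) * (p ^ k) ^ n)"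
  proof
    fix N
    have "(\<Prod>n<N * k. 1 + x * p ^ n) = (\<Prod>m<N. \<Prod>n\<in>{m * k..<m * k + k}. 1 + x * p ^ n)"
      by (rule prod.nat_group [symmetric])
    also have "\<dots> = (\<Prod>m<N. \<Prod>j<k. 1 + x * p ^ (j + m * k))"
    proof (rule prod.cong[OF refl])
      fix m
      show "(\<Prod>n\<in>{m * k..<m * k + k}. 1 + x * p ^ n) = (\<Prod>j<k. 1 + x * p ^ (j + m * k))"
        by (rule prod.reindex_bij_witness[of _ "\<lambda>j. j + m * k" "\<lambda>n. n - m * k"]) auto
    qed
    also have "\<dots> = (\<Prod>j<k. \<Prod>m<N. 1 + x * p ^ (j + m * k))"
      by (rule prod.swap)
    finally show "(\<Prod>n<N * k. 1 + x * p ^ n) = (\<Prod>j<k. \<Prod>n<N. 1 + (x * p ^ j) * (p ^ k) ^ n)"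
      by (simp add: power_add power_mult [symmetric] mult_ac)
  qed
  finally show "(\<lambda>N. \<Prod>j<k. \<Prod>n<N. 1 + (x * p ^ j) * (p ^ k) ^ n) \<longlonglongrightarrow> qprod x p" .
qed

section \<open>Absolute convergence of the bilateral theta series\<close>

lemma power_nat_abs_summable_on_int:
  fixes c :: real
  assumes "0 \<le> c" "c < 1"
  shows "(\<lambda>n::int. c ^ nat \<bar>n\<bar>) summable_on UNIV"
proof -
  have s: "(\<lambda>n. c ^ n) summable_on (UNIV :: nat set)"
    using assms by (intro norm_summable_imp_summable_on) simp
  have "(\<lambda>n::int. c ^ nat \<bar>n\<bar>) summable_on range int"
    by (subst summable_on_reindex) (use s in \<open>auto simp: o_def\<close>)
  moreover have "(\<lambda>n::int. c ^ nat \<bar>n\<bar>) summable_on range (\<lambda>n. - int n)"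
    by (subst summable_on_reindex) (use s in \<open>auto simp: o_def inj_def\<close>)
  ultimately have "(\<lambda>n::int. c ^ nat \<bar>n\<bar>) summable_on (range int \<union> range (\<lambda>n. - int n))"
    by (rule summable_on_union)
  also have "range int \<union> range (\<lambda>n. - int n) = UNIV"
    by (auto intro: int_cases2)
  finally show ?thesis .
qed

text \<open>The two exponents are nonnegative and add up to \<open>n * n\<close>, which is at least
  the absolute value of \<open>n\<close>; a two-sided geometric series therefore dominates.\<close>

lemma theta_term_norm_summable:
  assumes "norm r < 1" "norm s < 1"
  shows "(\<lambda>n. norm (theta_term r s n)) summable_on UNIV"
proof -
  define c where "c = max (norm r) (norm s)"
  have c: "0 \<le> c" "c < 1" "norm r \<le> c" "norm s \<le> c"
    using assms by (auto simp: c_def le_max_iff_disj)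
  have le: "norm (theta_term r s n) \<le> c ^ nat \<bar>n\<bar>" for n
  proof -
    define A B where "A = n * (n + 1) div 2" and "B = n * (n - 1) div 2"
    have A: "2 * A = n * (n + 1)" and B: "2 * B = n * (n - 1)"
      by (simp_all add: A_def B_def)
    have "n * (n + 1) \<ge> 0" "n * (n - 1) \<ge> 0"
      by (auto simp: zero_le_mult_iff)
    hence AB: "A \<ge> 0" "B \<ge> 0" using A B by linarith+
    have "A + B = n * n" using A B by (simp add: algebra_simps)
    moreover have "\<bar>n\<bar> * 1 \<le> \<bar>n\<bar> * \<bar>n\<bar>" by (cases "n = 0") (auto intro!: mult_left_mono simp del: abs_mult_self_eq mult_1_right)
    ultimately have "nat \<bar>n\<bar> \<le> nat A + nat B" using AB by (simp add: nat_le_iff)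
    have "norm (theta_term r s n) = norm r ^ nat A * norm s ^ nat B"
      using AB by (simp add: theta_term_def A_def B_def norm_mult power_int_def norm_power)
    also have "\<dots> \<le> c ^ nat A * c ^ nat B"
      using c by (intro mult_mono power_mono) auto
    also have "\<dots> = c ^ (nat A + nat B)" by (simp add: power_add)
    also have "\<dots> \<le> c ^ nat \<bar>n\<bar>"
      using c \<open>nat \<bar>n\<bar> \<le> nat A + nat B\<close> by (intro power_decreasing) auto
    finally show ?thesis .
  qed
  show ?thesis
    by (rule summable_on_comparison_test[OF power_nat_abs_summable_on_int[OF c(1,2)]])
       (use le in auto)
qed

lemma theta_term_has_sum:
  assumes "norm r < 1" "norm s < 1"
  shows "(theta_term r s has_sum ramanujan_f r s) UNIV"
proof -
  have "theta_term r s summable_on UNIV"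
    by (rule abs_summable_summable) (rule theta_term_norm_summable[OF assms])
  thus ?thesis
    unfolding ramanujan_f_def theta_term_def [abs_def] by (rule has_sum_infsum)
qed

section \<open>The finite form of the triple product\<close>

lemma theta_term_Suc:
  assumes "r \<noteq> 0" "s \<noteq> 0"
  shows "theta_term r s (n + 1) = r * (r * s) powi n * theta_term r s n"
proof -
  \<comment> \<open>Passing from \<open>n\<close> to \<open>n + 1\<close> raises the triangular
    exponents by \<open>n + 1\<close> and \<open>n\<close>, which gives the ratio
    \<open>r * (r * s) powi n\<close> of consecutive terms.\<close>
  have *: "(n + 1) * (n + 1 + 1) div 2 = n * (n + 1) div 2 + (n + 1)"
    "(n + 1) * (n + 1 - 1) div 2 = n * (n - 1) div 2 + n"
    by (simp_all add: algebra_simps)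
  show ?thesis
    unfolding theta_term_def * using assms
    by (simp add: power_int_add power_int_mult_distrib)
qed

text \<open>This is the finite symbol (p; p)_n, written literally as a partial product of
  \<open>qprod (- p) p\<close>, its limit.\<close>

definition qfact :: "complex \<Rightarrow> nat \<Rightarrow> complex" where
  "qfact p n = (\<Prod>k<n. 1 + (- p) * p ^ k)"

text \<open>Extending \<open>1 / qfact p\<close> by 0 to negative arguments makes the recursion
  \<open>qfact_recip_diff\<close> hold for all integers, so no boundary cases occur in the finite
  triple product.\<close>

definition qfact_recip :: "complex \<Rightarrow> int \<Rightarrow> complex" where
  "qfact_recip p m = (if m < 0 then 0 else 1 / qfact p (nat m))"

lemma qfact_nonzero:
  assumes "norm p < 1"
  shows "qfact p n \<noteq> 0"
  unfolding qfact_def using one_plus_mult_power_nonzero[of p "- p"] assms by simp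

text \<open>For positive \<open>m\<close> this cancels the last factor of \<open>qfact\<close>; for
  \<open>m = 0\<close> the factor \<open>1 - p powi m\<close> vanishes, and for negative
  \<open>m\<close> both sides are 0.\<close>

lemma qfact_recip_diff:
  assumes "norm p < 1"
  shows "qfact_recip p (m - 1) = (1 - p powi m) * qfact_recip p m"
proof (cases "m > 0")
  case True
  define k where "k = nat m - 1"
  have m: "m = int (Suc k)" using True by (simp add: k_def)
  have "qfact p (Suc k) = qfact p k * (1 - p ^ Suc k)"
    by (simp add: qfact_def)
  thus ?thesis
    using qfact_nonzero[OF assms, of k] qfact_nonzero[OF assms, of "Suc k"]
    unfolding m qfact_recip_def by (auto simp: power_int_def nat_add_distrib)
qed (cases "m = 0"; auto simp: qfact_recip_def)

text \<open>The coefficients are the Gaussian binomials of \<open>2 * n\<close> over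
  \<open>n + j\<close>, so only the \<open>j\<close> of absolute value at most \<open>n\<close>
  contribute. Summing over all integers makes index shifts bijections in the induction.\<close>

lemma finite_triple_product:
  assumes nz: "r \<noteq> 0" "s \<noteq> 0" and p: "norm (r * s) < 1"
  shows "((\<lambda>j. qfact (r * s) (2 * n) * qfact_recip (r * s) (int n + j) * qfact_recip (r * s) (int n - j)
            * theta_term r s j) has_sum (\<Prod>k<n. (1 + r * (r * s) ^ k) * (1 + s * (r * s) ^ k))) UNIV"
proof (induction n)
  case 0
  show ?case
    by (rule has_sum_finite_neutralI[of "{0}"])
       (auto simp: qfact_recip_def qfact_def theta_term_def)
next
  case (Suc n)
  define p where "p = r * s"
  have pnz: "p \<noteq> 0" and pn: "norm p < 1" using nz p by (auto simp: p_def)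
  define R where "R = qfact_recip p"
  define T where "T = theta_term r s"
  define F where "F = (\<Prod>k<n. (1 + r * p ^ k) * (1 + s * p ^ k))"
  define g where "g = (\<lambda>j. qfact p (2 * n) * R (int n + j) * R (int n - j) * T j)"
  have g: "(g has_sum F) UNIV"
    using Suc unfolding g_def F_def R_def T_def p_def .
  have g1: "((\<lambda>j. g (j - 1)) has_sum F) UNIV"
    using g by (subst has_sum_reindex_bij_betw[of "\<lambda>j. j - 1" UNIV UNIV])
      (auto intro: bij_betwI[of _ _ _ "\<lambda>j. j + 1"])
  have g2: "((\<lambda>j. g (j + 1)) has_sum F) UNIV"
    using g by (subst has_sum_reindex_bij_betw[of "\<lambda>j. j + 1" UNIV UNIV])
      (auto intro: bij_betwI[of _ _ _ "\<lambda>j. j - 1"])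
  \<comment> \<open>The new factor \<open>(1 + r * p ^ n) * (1 + s * p ^ n)\<close> has four terms.
    The parts with \<open>r\<close> and \<open>s\<close> are paired with the sum shifted by one in
    either direction, since these factors turn \<open>T (j - 1)\<close> and \<open>T (j + 1)\<close>
    into multiples of \<open>T j\<close>.\<close>
  have "((\<lambda>j. (1 + p ^ (2 * n + 1)) * g j + r * p ^ n * g (j - 1) + s * p ^ n * g (j + 1)) has_sum
          (1 + p ^ (2 * n + 1)) * F + r * p ^ n * F + s * p ^ n * F) UNIV"
    by (intro has_sum_add has_sum_cmult_right g g1 g2)
  also have "(1 + p ^ (2 * n + 1)) * F + r * p ^ n * F + s * p ^ n * F
      = (\<Prod>k<Suc n. (1 + r * p ^ k) * (1 + s * p ^ k))"
  proof -
    have "(\<Prod>k<Suc n. (1 + r * p ^ k) * (1 + s * p ^ k)) = F * ((1 + r * p ^ n) * (1 + s * p ^ n))"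
      by (simp add: F_def)
    also have "(1 + r * p ^ n) * (1 + s * p ^ n) = 1 + r * s * (p ^ n * p ^ n) + r * p ^ n + s * p ^ n"
      by (simp add: algebra_simps)
    also have "r * s * (p ^ n * p ^ n) = p ^ (2 * n + 1)"
      by (simp add: mult_2 power_add flip: p_def)
    finally show ?thesis by (simp add: algebra_simps)
  qed
  also have "(\<lambda>j. (1 + p ^ (2 * n + 1)) * g j + r * p ^ n * g (j - 1) + s * p ^ n * g (j + 1))
      = (\<lambda>j. qfact p (2 * Suc n) * R (int (Suc n) + j) * R (int (Suc n) - j) * T j)"
  proof
    fix j
    \<comment> \<open>In these variables every term is a rational function of \<open>A\<close>,
      \<open>B\<close>, \<open>p\<close> times \<open>U * V * T j\<close>, so the induction step
      becomes one algebraic identity.\<close>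
    define A B where "A = p powi (int (Suc n) + j)" and "B = p powi (int (Suc n) - j)"
    define U V where "U = R (int (Suc n) + j)" and "V = R (int (Suc n) - j)"
    have AB: "A * B = p ^ (2 * n + 2)"
    proof -
      have "A * B = p powi int (2 * n + 2)"
        using pnz by (simp add: A_def B_def flip: power_int_add)
      thus ?thesis by (simp only: power_int_of_nat)
    qed
    have Ap: "p powi (int n + j) = A / p" and Bp: "p powi (int n - j) = B / p"
      using pnz by (simp_all add: A_def B_def power_int_add power_int_diff)
    have R1: "R (int n + j) = (1 - A) * U"
      using qfact_recip_diff[OF pn, of "int (Suc n) + j"] by (simp add: A_def U_def R_def)
    have R2: "R (int n - j) = (1 - B) * V"
      using qfact_recip_diff[OF pn, of "int (Suc n) - j"] by (simp add: B_def V_def R_def)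
    have R3: "R (int n + (j - 1)) = (1 - A / p) * ((1 - A) * U)"
      using qfact_recip_diff[OF pn, of "int n + j"] R1 Ap by (simp add: R_def add_diff_eq)
    have R4: "R (int n - (j + 1)) = (1 - B / p) * ((1 - B) * V)"
      using qfact_recip_diff[OF pn, of "int n - j"] R2 Bp by (simp add: R_def diff_diff_eq)
    have R5: "R (int n - (j - 1)) = V" "R (int n + (j + 1)) = U"
      by (simp_all add: U_def V_def algebra_simps)
    have T1: "r * p ^ n * T (j - 1) = B * T j"
    proof -
      have "T j = r * p powi (j - 1) * T (j - 1)"
        using theta_term_Suc[OF nz, of "j - 1"] by (simp add: T_def p_def)
      moreover have "B * p powi (j - 1) = p powi int n"
        using pnz by (simp add: B_def flip: power_int_add)
      ultimately show ?thesis by (simp add: mult_ac)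
    qed
    have T2: "s * p ^ n * T (j + 1) = A * T j"
    proof -
      have "T (j + 1) = r * p powi j * T j"
        using theta_term_Suc[OF nz, of j] by (simp add: T_def p_def)
      moreover have "A = s * p ^ n * (r * p powi j)"
        using pnz by (simp add: A_def power_int_add p_def mult_ac)
      ultimately show ?thesis by simp
    qed
    have D: "qfact p (2 * Suc n) = qfact p (2 * n) * (1 - A * B / p) * (1 - A * B)"
      using pnz by (simp add: AB qfact_def)
    have pw: "p ^ (2 * n + 1) = A * B / p" using pnz by (simp add: AB)
    have "(1 + p ^ (2 * n + 1)) * g j + r * p ^ n * g (j - 1) + s * p ^ n * g (j + 1)
      = qfact p (2 * n) * ((1 + A * B / p) * (R (int n + j) * R (int n - j)) * T j
         + R (int n + (j - 1)) * R (int n - (j - 1)) * (r * p ^ n * T (j - 1))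
         + R (int n + (j + 1)) * R (int n - (j + 1)) * (s * p ^ n * T (j + 1)))"
      unfolding g_def pw by (simp only: algebra_simps)
    also have "\<dots> = qfact p (2 * n) * (((1 + A * B / p) * ((1 - A) * (1 - B))
         + (1 - A / p) * (1 - A) * B + (1 - B / p) * (1 - B) * A) * (U * V * T j))"
      unfolding R1 R2 R3 R4 R5 T1 T2 by (simp only: algebra_simps)
    \<comment> \<open>The right side is the quotient of \<open>qfact p (2 * Suc n)\<close> by
      \<open>qfact p (2 * n)\<close>, because \<open>A * B = p ^ (2 * n + 2)\<close>.\<close>
    also have "(1 + A * B / p) * ((1 - A) * (1 - B))
         + (1 - A / p) * (1 - A) * B + (1 - B / p) * (1 - B) * A = (1 - A * B / p) * (1 - A * B)"
      using pnz by (simp add: field_simps)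
    also have "qfact p (2 * n) * ((1 - A * B / p) * (1 - A * B) * (U * V * T j))
        = qfact p (2 * Suc n) * U * V * T j"
      unfolding D by (simp only: mult_ac)
    finally show "(1 + p ^ (2 * n + 1)) * g j + r * p ^ n * g (j - 1) + s * p ^ n * g (j + 1)
      = qfact p (2 * Suc n) * R (int (Suc n) + j) * R (int (Suc n) - j) * T j"
      unfolding U_def V_def .
  qed
  finally show ?case unfolding R_def T_def p_def .
qed

section \<open>From the finite to the infinite triple product\<close>

text \<open>Tannery's theorem: Lebesgue's dominated convergence for the counting measure, with
  \<open>infsetsum\<close> as the bridge between \<open>infsum\<close> and the integral.\<close>

lemma infsum_dominated_convergence:
  fixes f :: "'a \<Rightarrow> 'b :: {banach, second_countable_topology}"
  assumes "\<And>x. x \<in> A \<Longrightarrow> (\<lambda>i. g i x) \<longlonglongrightarrow> f x"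
    and "\<And>i x. x \<in> A \<Longrightarrow> norm (g i x) \<le> w x"
    and "w summable_on A"
  shows "(\<lambda>i. infsum (g i) A) \<longlonglongrightarrow> infsum f A"
proof -
  have wn: "0 \<le> w x" if "x \<in> A" for x
    using assms(2)[OF that] norm_ge_zero order_trans by blast
  have "(\<lambda>x. norm (w x)) summable_on A"
    using assms(3) by (rule summable_on_cong[THEN iffD1, rotated]) (use wn in auto)
  hence w: "integrable (count_space A) w"
    using abs_summable_equivalent[of w A] by (simp add: abs_summable_on_def)
  note D = integrable_dominated_convergence integrable_dominated_convergence2 integral_dominated_convergence
  have 1: "infsetsum (g i) A = infsum (g i) A" for i
    by (intro infsetsum_infsum, unfold abs_summable_on_def, rule D(2)[OF _ _ w])
       (use assms in \<open>auto simp: AE_count_space\<close>)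
  have 2: "infsetsum f A = infsum f A"
    by (intro infsetsum_infsum, unfold abs_summable_on_def, rule D(1)[where s = g, OF _ _ w])
       (use assms in \<open>auto simp: AE_count_space\<close>)
  have "(\<lambda>i. infsetsum (g i) A) \<longlonglongrightarrow> infsetsum f A"
    unfolding infsetsum_def
    by (rule D(3)[OF _ _ w]) (use assms in \<open>auto simp: AE_count_space\<close>)
  thus ?thesis by (simp add: 1 2)
qed

text \<open>Let \<open>n\<close> tend to infinity in the finite form. With \<open>E\<close> the
  limit of \<open>qfact p\<close>, each coefficient tends to \<open>E * (1 / E) * (1 / E)\<close>,
  and boundedness of \<open>qfact\<close> and \<open>qfact_recip\<close> gives a summable
  majorant.\<close>

theorem jacobi_triple_product:
  assumes nz: "r \<noteq> 0" "s \<noteq> 0" and lt: "norm r < 1" "norm s < 1"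
  shows "ramanujan_f r s = qprod r (r * s) * qprod s (r * s) * qprod (- (r * s)) (r * s)"
proof -
  define p where "p = r * s"
  have pn: "norm p < 1" and pnz: "p \<noteq> 0"
    using norm_mult_power_less_1[OF lt(2,1), of 1] nz by (auto simp: p_def)
  define E where "E = qprod (- p) p"
  have E: "E \<noteq> 0" using pn by (simp add: E_def qprod_nonzero)
  have D: "qfact p \<longlonglongrightarrow> E"
    using qprod_LIMSEQ[of p "- p"] pn by (simp add: qfact_def [abs_def] E_def)
  have R: "(\<lambda>n. qfact_recip p (int n)) \<longlonglongrightarrow> 1 / E"
    using tendsto_divide[OF tendsto_const D E, of 1] by (simp add: qfact_recip_def)
  obtain C where C: "\<And>n. norm (qfact p n) \<le> C"
    using convergent_imp_Bseq[of "qfact p"] D unfolding Bseq_def convergent_def by blast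
  obtain K where K: "\<And>n. norm (qfact_recip p (int n)) \<le> K"
    using convergent_imp_Bseq[OF convergentI[OF R]] unfolding Bseq_def by blast
  have C0: "0 \<le> C" using C[of 0] norm_ge_zero order_trans by blast
  have K0: "0 \<le> K" using K[of 0] norm_ge_zero order_trans by blast
  \<comment> \<open>The bound must also cover negative arguments, since \<open>int n - j\<close> and
    \<open>int n + j\<close> can be negative; there the value is 0.\<close>
  have K': "norm (qfact_recip p m) \<le> K" for m
    using K[of "nat m"] K0 by (cases "m < 0") (auto simp: qfact_recip_def)
  have R': "(\<lambda>n. qfact_recip p (int n + j)) \<longlonglongrightarrow> 1 / E" for j
  proof -
    have "filterlim (\<lambda>n. nat (int n + j)) at_top sequentially"
      unfolding filterlim_at_top
    proof
      fix Z show "\<forall>\<^sub>F n in sequentially. Z \<le> nat (int n + j)"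
        using eventually_ge_at_top[of "Z + nat \<bar>j\<bar>"] by eventually_elim auto
    qed
    from filterlim_compose[OF R this]
    show ?thesis
    proof (rule Lim_transform_eventually)
      show "\<forall>\<^sub>F n in sequentially. qfact_recip p (int (nat (int n + j))) = qfact_recip p (int n + j)"
        using eventually_ge_at_top[of "nat \<bar>j\<bar>"] by eventually_elim auto
    qed
  qed
  define g where "g = (\<lambda>n j. qfact p (2 * n) * qfact_recip p (int n + j) * qfact_recip p (int n - j)
            * theta_term r s j)"
  have "(\<lambda>n. infsum (g n) UNIV) \<longlonglongrightarrow> infsum (\<lambda>j. E * (1 / E) * (1 / E) * theta_term r s j) UNIV"
  proof (rule infsum_dominated_convergence)
    fix j
    have "(\<lambda>n. qfact p (2 * n)) \<longlonglongrightarrow> E"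
      using LIMSEQ_subseq_LIMSEQ[OF D, of "\<lambda>n. 2 * n"] by (simp add: o_def strict_mono_def)
    thus "(\<lambda>n. g n j) \<longlonglongrightarrow> E * (1 / E) * (1 / E) * theta_term r s j"
      unfolding g_def using R'[of j] R'[of "- j"] by (intro tendsto_intros) auto
  next
    fix n j
    show "norm (g n j) \<le> C * K * K * norm (theta_term r s j)"
      unfolding g_def norm_mult by (intro mult_mono C K' order_refl) (auto simp: C0 K0)
  next
    show "(\<lambda>j. C * K * K * norm (theta_term r s j)) summable_on UNIV"
      by (intro summable_on_cmult_right theta_term_norm_summable lt)
  qed
  moreover have "infsum (g n) UNIV = (\<Prod>k<n. 1 + r * p ^ k) * (\<Prod>k<n. 1 + s * p ^ k)" for n
    using infsumI[OF finite_triple_product[OF nz, of n]] pn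
    by (simp add: g_def p_def prod.distrib)
  moreover have "infsum (\<lambda>j. E * (1 / E) * (1 / E) * theta_term r s j) UNIV = 1 / E * ramanujan_f r s"
    using infsumI[OF has_sum_cmult_right[OF theta_term_has_sum[OF lt], of "1 / E"]] E by simp
  ultimately have "(\<lambda>n. (\<Prod>k<n. 1 + r * p ^ k) * (\<Prod>k<n. 1 + s * p ^ k)) \<longlonglongrightarrow> 1 / E * ramanujan_f r s"
    by simp
  moreover have "(\<lambda>n. (\<Prod>k<n. 1 + r * p ^ k) * (\<Prod>k<n. 1 + s * p ^ k)) \<longlonglongrightarrow> qprod r p * qprod s p"
    by (intro tendsto_mult qprod_LIMSEQ pn lt)
  ultimately have "1 / E * ramanujan_f r s = qprod r p * qprod s p"
    by (rule LIMSEQ_unique)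
  thus ?thesis using E by (simp add: E_def p_def field_simps)
qed

section \<open>Theta products as lattice sums\<close>

lemma has_sum_times_product:
  fixes f :: "'a \<Rightarrow> complex" and g :: "'b \<Rightarrow> complex"
  assumes "(f has_sum a) A" "(g has_sum b) B"
    and "(\<lambda>x. norm (f x)) summable_on A" "(\<lambda>y. norm (g y)) summable_on B"
  shows "((\<lambda>(x, y). f x * g y) has_sum a * b) (A \<times> B)"
proof (rule has_sum_SigmaI)
  show "((\<lambda>y. case (x, y) of (x, y) \<Rightarrow> f x * g y) has_sum f x * b) B" for x
    using has_sum_cmult_right[OF assms(2)] by simp
  show "((\<lambda>x. f x * b) has_sum a * b) A"
    by (rule has_sum_cmult_left[OF assms(1)])
  have "(\<lambda>z. norm (case z of (x, y) \<Rightarrow> f x * g y)) summable_on A \<times> B"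
  proof (rule summable_on_SigmaI)
    show "((\<lambda>y. norm (case (x, y) of (x, y) \<Rightarrow> f x * g y)) has_sum
             norm (f x) * infsum (\<lambda>y. norm (g y)) B) B" for x
      using has_sum_cmult_right[OF has_sum_infsum[OF assms(4)]] by (simp add: norm_mult)
    show "(\<lambda>x. norm (f x) * infsum (\<lambda>y. norm (g y)) B) summable_on A"
      by (rule summable_on_cmult_left[OF assms(3)])
  qed auto
  thus "(\<lambda>(x, y). f x * g y) summable_on A \<times> B"
    by (rule abs_summable_summable)
qed

lemma theta_term_power:
  assumes "2 * e = int a * (n * (n + 1)) + int b * (n * (n - 1))" "t \<noteq> 0"
  shows "theta_term (t ^ a) (t ^ b) n = t powi e"
proof -
  define A B where "A = n * (n + 1) div 2" and "B = n * (n - 1) div 2"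
  have "n * (n + 1) = 2 * A" "n * (n - 1) = 2 * B"
    by (simp_all add: A_def B_def)
  with assms(1) have "e = int a * A + int b * B"
    by simp
  thus ?thesis
    unfolding theta_term_def A_def [symmetric] B_def [symmetric]
    using assms(2) by (simp add: power_int_add power_int_mult)
qed

text \<open>A product of two theta functions becomes one sum over the lattice of integer pairs,
  ready for a change of variables. The exponents are specified through their doubles, which lets
  callers supply polynomials free of \<open>div\<close>.\<close>

lemma ramanujan_f_power_product_has_sum:
  assumes t: "t \<noteq> 0" "norm t < 1" and pos: "a > 0" "b > 0" "c > 0" "d > 0"
    and e: "\<And>n. 2 * e n = int a * (n * (n + 1)) + int b * (n * (n - 1))"
    and e': "\<And>n. 2 * e' n = int c * (n * (n + 1)) + int d * (n * (n - 1))"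
  shows "((\<lambda>(m, n). t powi (e m + e' n)) has_sum
           ramanujan_f (t ^ a) (t ^ b) * ramanujan_f (t ^ c) (t ^ d)) UNIV"
proof -
  note lt = norm_power_less_1[OF t(2)]
  have "((\<lambda>(m, n). theta_term (t ^ a) (t ^ b) m * theta_term (t ^ c) (t ^ d) n) has_sum
           ramanujan_f (t ^ a) (t ^ b) * ramanujan_f (t ^ c) (t ^ d)) (UNIV \<times> UNIV)"
    by (intro has_sum_times_product theta_term_has_sum theta_term_norm_summable lt pos)
  thus ?thesis
    using t by (simp add: theta_term_power[OF e] theta_term_power[OF e'] power_int_add)
qed

text \<open>The Gaussian integers \<open>u + i v\<close> are sorted by the residue of \<open>u + 2 v\<close> modulo 5:
  the multiples of \<open>1 + 2 i\<close> contribute \<open>\<phi>(t^5)^2\<close>, and multiplication by \<open>i\<close> permutes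
  the four other classes.\<close>

lemma phi_square_diff:
  assumes t: "t \<noteq> 0" "norm t < 1"
  shows "ramanujan_phi t ^ 2 - ramanujan_phi (t ^ 5) ^ 2
           = 4 * t * ramanujan_f t (t ^ 9) * ramanujan_f (t ^ 3) (t ^ 7)"
proof -
  define S :: "int \<Rightarrow> (int \<times> int) set" where "S = (\<lambda>c. {(u, v). \<exists>k. u + 2 * v = 5 * k + c})"
  have t_powi: "t * t powi k = t powi (1 + k)" for k
    using t by (simp add: power_int_add)
  define g :: "int \<times> int \<Rightarrow> complex" where "g = (\<lambda>(u, v). t powi (u * u + v * v))"
  define w where "w = t * (ramanujan_f t (t ^ 9) * ramanujan_f (t ^ 3) (t ^ 7))"
  have g: "(g has_sum ramanujan_phi t ^ 2) UNIV"
    using ramanujan_f_power_product_has_sum[OF t, of 1 1 1 1 "\<lambda>n. n * n" "\<lambda>n. n * n"]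
    by (simp add: g_def ramanujan_phi_def algebra_simps power2_eq_square)

  \<comment> \<open>Multiplication of \<open>x + i y\<close> by \<open>1 + 2 i\<close>, which scales
    the norm form by 5.\<close>
  define j0 :: "int \<times> int \<Rightarrow> int \<times> int" where "j0 = (\<lambda>(x, y). (x - 2 * y, 2 * x + y))"
  have inj_j0: "inj j0" by (auto simp: j0_def inj_def)
  have "((\<lambda>(x, y). t powi (5 * (x * x) + 5 * (y * y))) has_sum ramanujan_phi (t ^ 5) ^ 2) UNIV"
    using ramanujan_f_power_product_has_sum[OF t, of 5 5 5 5 "\<lambda>n. 5 * (n * n)" "\<lambda>n. 5 * (n * n)"]
    by (simp add: ramanujan_phi_def algebra_simps power2_eq_square)
  also have "(\<lambda>(x, y). t powi (5 * (x * x) + 5 * (y * y))) = g \<circ> j0"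
    by (rule ext) (auto simp: g_def j0_def algebra_simps)
  finally have "(g has_sum ramanujan_phi (t ^ 5) ^ 2) (range j0)"
    by (simp add: has_sum_reindex[OF inj_j0] o_def)
  also have "range j0 = S 0"
  proof (intro equalityI subsetI)
    fix z assume "z \<in> S 0"
    then obtain u v k where "z = (u, v)" "u + 2 * v = 5 * k" by (auto simp: S_def)
    hence "z = j0 (k, v - 2 * k)" by (simp add: j0_def)
    thus "z \<in> range j0" by simp
  qed (auto simp: S_def j0_def)
  finally have g0: "(g has_sum ramanujan_phi (t ^ 5) ^ 2) (S 0)" .

  \<comment> \<open>Multiplication of \<open>m + i n\<close> by \<open>2 - i\<close>, an associate
    of \<open>1 + 2 i\<close>, followed by subtraction of 1: this is the coset of the same ideal on
    which \<open>u + 2 v\<close> is 4 modulo 5. The shift produces the linear terms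
    \<open>- 4 * m\<close> and \<open>- 2 * n\<close> and the factor \<open>t\<close>.\<close>
  define j4 :: "int \<times> int \<Rightarrow> int \<times> int" where "j4 = (\<lambda>(m, n). (2 * m + n - 1, 2 * n - m))"
  have inj_j4: "inj j4" by (auto simp: j4_def inj_def)
  have "((\<lambda>(m, n). t powi ((5 * (m * m) - 4 * m) + (5 * (n * n) - 2 * n))) has_sum
          ramanujan_f t (t ^ 9) * ramanujan_f (t ^ 3) (t ^ 7)) UNIV"
    using ramanujan_f_power_product_has_sum[OF t, of 1 9 3 7 "\<lambda>n. 5 * (n * n) - 4 * n" "\<lambda>n. 5 * (n * n) - 2 * n"]
    by (simp add: algebra_simps)
  from has_sum_cmult_right[OF this, of t]
  have "((\<lambda>(m, n). t * t powi ((5 * (m * m) - 4 * m) + (5 * (n * n) - 2 * n))) has_sum w) UNIV"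
    by (simp add: case_prod_unfold w_def)
  also have "(\<lambda>(m, n). t * t powi ((5 * (m * m) - 4 * m) + (5 * (n * n) - 2 * n))) = g \<circ> j4"
  proof (rule ext, clarify)
    fix m n :: int
    have "(2 * m + n - 1) * (2 * m + n - 1) + (2 * n - m) * (2 * n - m)
        = 1 + ((5 * (m * m) - 4 * m) + (5 * (n * n) - 2 * n))"
      by (simp add: algebra_simps)
    thus "t * t powi ((5 * (m * m) - 4 * m) + (5 * (n * n) - 2 * n)) = (g \<circ> j4) (m, n)"
      by (simp only: g_def j4_def o_def prod.case t_powi)
  qed
  finally have "(g has_sum w) (range j4)"
    by (simp add: has_sum_reindex[OF inj_j4] o_def)
  also have "range j4 = S 4"
  proof (intro equalityI subsetI)
    fix z assume "z \<in> S 4"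
    then obtain u v k where "z = (u, v)" "u + 2 * v = 5 * k + 4" by (auto simp: S_def)
    hence "z = j4 (2 * k + 2 - v, k + 1)" by (simp add: j4_def)
    thus "z \<in> range j4" by simp
  next
    fix z assume "z \<in> range j4"
    then obtain m n where "z = (2 * m + n - 1, 2 * n - m)" by (auto simp: j4_def)
    thus "z \<in> S 4" by (auto simp: S_def intro: exI[of _ "n - 1"])
  qed
  finally have g4: "(g has_sum w) (S 4)" .

  \<comment> \<open>Multiplication by \<open>i\<close> preserves the norm form and doubles
    \<open>u + 2 v\<close> modulo 5; \<open>d\<close> records the carry. The classes are thus
    visited in the order 4, 3, 1, 2.\<close>
  have rot: "(g has_sum x) (S c')" if "(g has_sum x) (S c)" and c: "2 * c = c' + 5 * d" for c c' d x
  proof -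
    define j :: "int \<times> int \<Rightarrow> int \<times> int" where "j = (\<lambda>(u, v). (- v, u))"
    have inj: "inj_on j (S c)" by (auto simp: j_def inj_on_def)
    have "g \<circ> j = g" by (auto simp: g_def j_def fun_eq_iff add.commute)
    hence "(g has_sum x) (j ` S c)"
      using that(1) inj by (subst has_sum_reindex) simp_all
    also have "j ` S c = S c'"
    proof (intro equalityI subsetI)
      fix z assume "z \<in> S c'"
      then obtain u v k where z: "z = (u, v)" "u + 2 * v = 5 * k + c'" by (auto simp: S_def)
      hence "v + 2 * (- u) = 5 * (v - 2 * k - c + 2 * d) + c" using c by simp
      hence "(v, - u) \<in> S c" unfolding S_def by blast
      moreover have "z = j (v, - u)" using z by (simp add: j_def)
      ultimately show "z \<in> j ` S c" by blast
    next
      fix z assume "z \<in> j ` S c"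
      then obtain u v k where z: "z = (- v, u)" "u + 2 * v = 5 * k + c" by (auto simp: S_def j_def)
      hence "- v + 2 * u = 5 * (2 * k - v + d) + c'" using c by simp
      thus "z \<in> S c'" unfolding S_def z by blast
    qed
    finally show ?thesis .
  qed
  have g3: "(g has_sum w) (S 3)" by (rule rot[OF g4, of _ 1]) simp
  have g1: "(g has_sum w) (S 1)" by (rule rot[OF g3, of _ 1]) simp
  have g2: "(g has_sum w) (S 2)" by (rule rot[OF g1, of _ 0]) simp
  have disj: "S c \<inter> S c' = {}" if "c \<in> {0..4}" "c' \<in> {0..4}" "c \<noteq> c'" for c c'
  proof -
    have "5 * k + c \<noteq> 5 * k' + c'" for k k' using that by auto presburger
    hence "z \<notin> S c \<inter> S c'" for z unfolding S_def by (cases z) (simp, metis)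
    thus ?thesis by blast
  qed
  have "(g has_sum ramanujan_phi (t ^ 5) ^ 2 + w + w + w + w) (S 0 \<union> S 1 \<union> S 2 \<union> S 3 \<union> S 4)"
    by (intro has_sum_Un_disjoint g0 g1 g2 g3 g4) (simp_all add: Int_Un_distrib2 disj)
  also have "S 0 \<union> S 1 \<union> S 2 \<union> S 3 \<union> S 4 = UNIV"
  proof -
    have "z \<in> S 0 \<union> S 1 \<union> S 2 \<union> S 3 \<union> S 4" for z
    proof -
      obtain u v where z: "z = (u, v)" by (cases z)
      define n where "n = u + 2 * v"
      have "\<exists>k. n = 5 * k + 0 \<or> n = 5 * k + 1 \<or> n = 5 * k + 2 \<or> n = 5 * k + 3 \<or> n = 5 * k + 4"
        by presburger
      thus ?thesis unfolding S_def z n_def by blast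
    qed
    thus ?thesis by blast
  qed
  finally have "ramanujan_phi t ^ 2 = ramanujan_phi (t ^ 5) ^ 2 + w + w + w + w"
    by (rule has_sum_unique[OF g])
  thus ?thesis by (simp add: w_def)
qed

text \<open>The two terms on the right collect the index pairs \<open>(m, n)\<close> with \<open>m + n\<close> even and odd.\<close>

lemma ramanujan_f_quintic_product:
  assumes t: "t \<noteq> 0" "norm t < 1"
  shows "ramanujan_f t (t ^ 4) * ramanujan_f (t ^ 2) (t ^ 3)
       = ramanujan_f (t ^ 4) (t ^ 6) * ramanujan_f (t ^ 3) (t ^ 7)
         + t * ramanujan_f (t ^ 2) (t ^ 8) * ramanujan_f t (t ^ 9)"
proof -
  define S :: "int \<Rightarrow> (int \<times> int) set" where "S = (\<lambda>c. {(m, n). \<exists>k. m + n = 2 * k + c})"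
  define e e' :: "int \<Rightarrow> int" where
    "e = (\<lambda>n. n * (n + 1) div 2 + 4 * (n * (n - 1) div 2))" and
    "e' = (\<lambda>n. 2 * (n * (n + 1) div 2) + 3 * (n * (n - 1) div 2))"
  have e: "2 * e n = 5 * (n * n) - 3 * n" and e': "2 * e' n = 5 * (n * n) - n" for n
  proof -
    define A B where "A = n * (n + 1) div 2" and "B = n * (n - 1) div 2"
    have "2 * A = n * n + n" "2 * B = n * n - n"
      by (simp_all add: A_def B_def algebra_simps)
    thus "2 * e n = 5 * (n * n) - 3 * n" "2 * e' n = 5 * (n * n) - n"
      unfolding e_def e'_def A_def [symmetric] B_def [symmetric] by auto
  qed
  have t_powi: "t * t powi k = t powi (1 + k)" for k
    using t by (simp add: power_int_add)
  define g :: "int \<times> int \<Rightarrow> complex" where "g = (\<lambda>(m, n). t powi (e m + e' n))"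
  define w where "w = t * (ramanujan_f (t ^ 2) (t ^ 8) * ramanujan_f t (t ^ 9))"
  have g: "(g has_sum ramanujan_f t (t ^ 4) * ramanujan_f (t ^ 2) (t ^ 3)) UNIV"
  proof -
    have "2 * e n = int 1 * (n * (n + 1)) + int 4 * (n * (n - 1))"
      "2 * e' n = int 2 * (n * (n + 1)) + int 3 * (n * (n - 1))" for n
      unfolding e e' by (simp_all add: algebra_simps)
    from ramanujan_f_power_product_has_sum[OF t _ _ _ _ this] show ?thesis
      by (simp add: g_def)
  qed

  \<comment> \<open>For \<open>m = x + y\<close>, \<open>n = y - x\<close> the quadratic form has no
    mixed term, so the exponent splits into a part in \<open>x\<close> and a part in
    \<open>y\<close>.\<close>
  define j0 :: "int \<times> int \<Rightarrow> int \<times> int" where "j0 = (\<lambda>(x, y). (x + y, y - x))"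
  have inj_j0: "inj j0" by (auto simp: j0_def inj_def)
  have "((\<lambda>(x, y). t powi ((5 * (x * x) - x) + (5 * (y * y) - 2 * y))) has_sum
          ramanujan_f (t ^ 4) (t ^ 6) * ramanujan_f (t ^ 3) (t ^ 7)) UNIV"
    using ramanujan_f_power_product_has_sum[OF t, of 4 6 3 7 "\<lambda>n. 5 * (n * n) - n" "\<lambda>n. 5 * (n * n) - 2 * n"]
    by (simp add: algebra_simps)
  also have "(\<lambda>(x, y). t powi ((5 * (x * x) - x) + (5 * (y * y) - 2 * y))) = g \<circ> j0"
  proof (rule ext, clarify)
    fix x y :: int
    have "2 * (e (x + y) + e' (y - x)) = 2 * ((5 * (x * x) - x) + (5 * (y * y) - 2 * y))"
      unfolding distrib_left e e' by (simp add: algebra_simps)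
    hence "e (x + y) + e' (y - x) = (5 * (x * x) - x) + (5 * (y * y) - 2 * y)"
      by (simp only: mult_cancel_left) simp
    thus "t powi ((5 * (x * x) - x) + (5 * (y * y) - 2 * y)) = (g \<circ> j0) (x, y)"
      by (simp add: g_def j0_def)
  qed
  finally have "(g has_sum ramanujan_f (t ^ 4) (t ^ 6) * ramanujan_f (t ^ 3) (t ^ 7)) (range j0)"
    by (simp add: has_sum_reindex[OF inj_j0] o_def)
  also have "range j0 = S 0"
  proof (intro equalityI subsetI)
    fix z assume "z \<in> S 0"
    then obtain m n k where "z = (m, n)" "m + n = 2 * k" by (auto simp: S_def)
    hence "z = j0 (m - k, k)" by (simp add: j0_def)
    thus "z \<in> range j0" by simp
  qed (auto simp: S_def j0_def)
  finally have g0: "(g has_sum ramanujan_f (t ^ 4) (t ^ 6) * ramanujan_f (t ^ 3) (t ^ 7)) (S 0)" .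

  \<comment> \<open>The index sum is \<open>1 - 2 * x\<close>, hence odd. The signs are chosen so
    that the linear terms come out as \<open>- 3 * x\<close> and \<open>- 4 * y\<close>, the
    exponents of the two target series; the constant 1 left over is the factor
    \<open>t\<close>.\<close>
  define j1 :: "int \<times> int \<Rightarrow> int \<times> int" where "j1 = (\<lambda>(x, y). (1 - x - y, y - x))"
  have inj_j1: "inj j1" by (auto simp: j1_def inj_def)
  have "((\<lambda>(x, y). t powi ((5 * (x * x) - 3 * x) + (5 * (y * y) - 4 * y))) has_sum
          ramanujan_f (t ^ 2) (t ^ 8) * ramanujan_f t (t ^ 9)) UNIV"
    using ramanujan_f_power_product_has_sum[OF t, of 2 8 1 9 "\<lambda>n. 5 * (n * n) - 3 * n" "\<lambda>n. 5 * (n * n) - 4 * n"]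
    by (simp add: algebra_simps)
  from has_sum_cmult_right[OF this, of t]
  have "((\<lambda>(x, y). t * t powi ((5 * (x * x) - 3 * x) + (5 * (y * y) - 4 * y))) has_sum w) UNIV"
    by (simp add: case_prod_unfold w_def)
  also have "(\<lambda>(x, y). t * t powi ((5 * (x * x) - 3 * x) + (5 * (y * y) - 4 * y))) = g \<circ> j1"
  proof (rule ext, clarify)
    fix x y :: int
    have "2 * (e (1 - x - y) + e' (y - x)) = 2 * (1 + ((5 * (x * x) - 3 * x) + (5 * (y * y) - 4 * y)))"
      unfolding distrib_left e e' by (simp add: algebra_simps)
    hence "e (1 - x - y) + e' (y - x) = 1 + ((5 * (x * x) - 3 * x) + (5 * (y * y) - 4 * y))"
      by (simp only: mult_cancel_left) simp
    thus "t * t powi ((5 * (x * x) - 3 * x) + (5 * (y * y) - 4 * y)) = (g \<circ> j1) (x, y)"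
      by (simp only: g_def j1_def o_def prod.case t_powi)
  qed
  finally have "(g has_sum w) (range j1)"
    by (simp add: has_sum_reindex[OF inj_j1] o_def)
  also have "range j1 = S 1"
  proof (intro equalityI subsetI)
    fix z assume "z \<in> S 1"
    then obtain m n k where "z = (m, n)" "m + n = 2 * k + 1" by (auto simp: S_def)
    hence "z = j1 (- k, n - k)" by (simp add: j1_def)
    thus "z \<in> range j1" by simp
  next
    fix z assume "z \<in> range j1"
    then obtain x y where "z = (1 - x - y, y - x)" by (auto simp: j1_def)
    thus "z \<in> S 1" by (auto simp: S_def intro: exI[of _ "- x"])
  qed
  finally have g1: "(g has_sum w) (S 1)" .

  have "S 0 \<inter> S 1 = {}"
    by (auto simp: S_def) presburger
  from has_sum_Un_disjoint[OF g0 g1 this]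
  have "(g has_sum ramanujan_f (t ^ 4) (t ^ 6) * ramanujan_f (t ^ 3) (t ^ 7) + w) (S 0 \<union> S 1)" .
  also have "S 0 \<union> S 1 = UNIV"
    by (auto simp: S_def) presburger
  finally show ?thesis
    using has_sum_unique[OF g] by (simp add: w_def mult.assoc)
qed

section \<open>Evaluation of theta quotients\<close>

lemma ramanujan_f_nonzero:
  assumes "r \<noteq> 0" "s \<noteq> 0" "norm r < 1" "norm s < 1"
  shows "ramanujan_f r s \<noteq> 0"
proof -
  have "norm (r * s) < 1"
    using norm_mult_power_less_1[of s r 1] assms by simp
  thus ?thesis using assms by (simp add: jacobi_triple_product qprod_nonzero)
qed

lemma qprod_even_odd:
  assumes "norm p < 1" "norm x < 1"
  shows "qprod x p = qprod x (p ^ 2) * qprod (x * p) (p ^ 2)"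
  using qprod_split[OF assms, of 2] by (simp add: numeral_2_eq_2)

lemma ramanujan_phi_qprod:
  assumes "x \<noteq> 0" "norm x < 1"
  shows "ramanujan_phi x = qprod x (x ^ 2) ^ 2 * qprod (- (x ^ 2)) (x ^ 2)"
  using assms by (simp add: ramanujan_phi_def jacobi_triple_product power2_eq_square)

text \<open>The products from \<open>x\<close> and \<open>x ^ 3\<close> with base
  \<open>x ^ 4\<close> are the even and odd halves of a single product with base
  \<open>x ^ 2\<close>.\<close>

lemma ramanujan_psi_qprod:
  assumes "x \<noteq> 0" "norm x < 1"
  shows "ramanujan_psi x = qprod x (x ^ 2) * qprod (- (x ^ 4)) (x ^ 4)"
proof -
  have "norm (x ^ 3) < 1" "norm (x ^ 2) < 1" using assms by (simp_all add: norm_power_less_1)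
  thus ?thesis
    using assms qprod_even_odd[of "x ^ 2" x]
    by (simp add: ramanujan_psi_def jacobi_triple_product flip: power_Suc power_mult)
qed

text \<open>On each left side the triple product yields four of the five residue classes of a
  product split modulo 5; the extra \<open>qprod\<close> supplies the missing class, so
  \<open>qprod_split\<close> reassembles the whole.\<close>

lemma ramanujan_f_pair_products:
  assumes t: "t \<noteq> 0" "norm t < 1"
  shows "ramanujan_f (t ^ 4) (t ^ 6) * ramanujan_f (t ^ 2) (t ^ 8) * qprod (t ^ 10) (t ^ 10)
           = qprod (t ^ 2) (t ^ 2) * qprod (- (t ^ 10)) (t ^ 10) ^ 2"
    and "ramanujan_f t (t ^ 9) * ramanujan_f (t ^ 3) (t ^ 7) * qprod (t ^ 5) (t ^ 10)
           = qprod t (t ^ 2) * qprod (- (t ^ 10)) (t ^ 10) ^ 2"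
    and "ramanujan_f t (t ^ 4) * ramanujan_f (t ^ 2) (t ^ 3) * qprod (t ^ 5) (t ^ 5)
           = qprod t t * qprod (- (t ^ 5)) (t ^ 5) ^ 2"
proof -
  note lt = norm_power_less_1[OF t(2)]
  have five: "(\<Prod>j<5. h j) = h 0 * h 1 * h 2 * h 3 * h 4" for h :: "nat \<Rightarrow> complex"
    by (simp add: eval_nat_numeral)
  have f: "ramanujan_f (t ^ a) (t ^ b)
      = qprod (t ^ a) (t ^ (a + b)) * qprod (t ^ b) (t ^ (a + b)) * qprod (- (t ^ (a + b))) (t ^ (a + b))"
    if "a > 0" "b > 0" for a b
    using jacobi_triple_product[of "t ^ a" "t ^ b"] that lt t by (simp add: power_add)
  have g: "qprod (t ^ a) (t ^ b) = (\<Prod>j<5. qprod (t ^ (a + b * j)) (t ^ (b * 5)))"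
    if "a > 0" "b > 0" for a b
    using qprod_split[of "t ^ b" "t ^ a" 5] that lt by (simp add: power_add power_mult)
  show "ramanujan_f (t ^ 4) (t ^ 6) * ramanujan_f (t ^ 2) (t ^ 8) * qprod (t ^ 10) (t ^ 10)
           = qprod (t ^ 2) (t ^ 2) * qprod (- (t ^ 10)) (t ^ 10) ^ 2"
    using f[of 4 6] f[of 2 8] g[of 2 2] by (simp add: five power2_eq_square [of "qprod _ _"] del: power_Suc add_2_eq_Suc add_2_eq_Suc')
  show "ramanujan_f t (t ^ 9) * ramanujan_f (t ^ 3) (t ^ 7) * qprod (t ^ 5) (t ^ 10)
           = qprod t (t ^ 2) * qprod (- (t ^ 10)) (t ^ 10) ^ 2"
    using f[of 1 9] f[of 3 7] g[of 1 2] by (simp add: five power2_eq_square [of "qprod _ _"] del: power_Suc add_2_eq_Suc add_2_eq_Suc')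
  show "ramanujan_f t (t ^ 4) * ramanujan_f (t ^ 2) (t ^ 3) * qprod (t ^ 5) (t ^ 5)
           = qprod t t * qprod (- (t ^ 5)) (t ^ 5) ^ 2"
    using f[of 1 4] f[of 2 3] g[of 1 1] by (simp add: five power2_eq_square [of "qprod _ _"] del: power_Suc add_2_eq_Suc add_2_eq_Suc' flip: numeral_2_eq_2)
qed

lemma qprod_neg_square:
  assumes "norm x < 1"
  shows "qprod (- (x ^ 2)) (x ^ 2) = qprod x x * qprod (- x) x"
  using qprod_mult_neg[of x x] assms by simp

lemma qprod_odd:
  assumes "norm x < 1"
  shows "qprod x x = qprod x (x ^ 2) * qprod (x ^ 2) (x ^ 2)"
    and "qprod (- x) x = qprod (- x) (x ^ 2) * qprod (- (x ^ 2)) (x ^ 2)"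
  using qprod_even_odd[of x x] qprod_even_odd[of x "- x"] assms by (simp_all add: power2_eq_square)

text \<open>Once every theta function is written in infinite products, both claims are rational
  identities between these products. The first evaluates the product of the reciprocals of the two
  quotients in the main theorem, the second their sum.\<close>

lemma quintic_theta_quotient:
  assumes t: "t \<noteq> 0" "norm t < 1"
  shows "ramanujan_f t (t ^ 9) * ramanujan_f (t ^ 3) (t ^ 7) * (ramanujan_phi (- (t ^ 10)) * ramanujan_psi t)
       = ramanujan_f (t ^ 4) (t ^ 6) * ramanujan_f (t ^ 2) (t ^ 8) * (ramanujan_phi t * ramanujan_psi (- (t ^ 5)))"
    and "ramanujan_f t (t ^ 4) * ramanujan_f (t ^ 2) (t ^ 3) * ramanujan_psi (t ^ 5) ^ 2
       = ramanujan_f (t ^ 4) (t ^ 6) * ramanujan_f (t ^ 2) (t ^ 8)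
         * (ramanujan_f t (t ^ 9) * ramanujan_f (t ^ 3) (t ^ 7))"
proof -
  note lt = norm_power_less_1[OF t(2)]
  \<comment> \<open>In q-Pochhammer notation with infinite index, \<open>G n\<close>,
    \<open>E n\<close>, \<open>H n\<close>, \<open>K n\<close> are (-t^n; t^n), (t^n; t^n), (-t^n;
    t^(2n)) and (t^n; t^(2n)).\<close>
  define G E H K where "G = (\<lambda>n. qprod (t ^ n) (t ^ n))" and "E = (\<lambda>n. qprod (- (t ^ n)) (t ^ n))"
    and "H = (\<lambda>n. qprod (t ^ n) (t ^ (2 * n)))" and "K = (\<lambda>n. qprod (- (t ^ n)) (t ^ (2 * n)))"
  have nz: "G n \<noteq> 0" "E n \<noteq> 0" "H n \<noteq> 0" "K n \<noteq> 0" if "n > 0" for n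
    unfolding G_def E_def H_def K_def using that by (simp_all add: qprod_nonzero lt)
  have E: "E (2 * n) = G n * E n" and G: "G n = H n * G (2 * n)" and K: "E n = K n * E (2 * n)" if "n > 0" for n
    using qprod_neg_square[OF lt[OF that]] qprod_odd[OF lt[OF that]]
    by (simp_all add: G_def E_def H_def K_def mult.commute flip: power_mult)
  have tn: "t ^ n \<noteq> 0" for n using t by simp
  have phi: "ramanujan_phi (t ^ n) = H n ^ 2 * E (2 * n)"
    and psi: "ramanujan_psi (t ^ n) = H n * E (4 * n)"
    and phi': "ramanujan_phi (- (t ^ n)) = K n ^ 2 * E (2 * n)"
    and psi': "ramanujan_psi (- (t ^ n)) = K n * E (4 * n)" if "n > 0" for n
    using ramanujan_phi_qprod[OF tn lt[OF that]] ramanujan_psi_qprod[OF tn lt[OF that]]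
      ramanujan_phi_qprod[of "- (t ^ n)"] ramanujan_psi_qprod[of "- (t ^ n)"] tn lt[OF that]
    by (simp_all add: E_def H_def K_def mult.commute flip: power_mult)
  define ab cd fg where "ab = ramanujan_f (t ^ 4) (t ^ 6) * ramanujan_f (t ^ 2) (t ^ 8)"
    and "cd = ramanujan_f t (t ^ 9) * ramanujan_f (t ^ 3) (t ^ 7)"
    and "fg = ramanujan_f t (t ^ 4) * ramanujan_f (t ^ 2) (t ^ 3)"
  have ab: "ab = G 2 * E 10 ^ 2 / G 10" and cd: "cd = H 1 * E 10 ^ 2 / H 5" and fg: "fg = G 1 * E 5 ^ 2 / G 5"
    using ramanujan_f_pair_products[OF t] nz[of 10] nz[of 5]
    by (simp_all add: ab_def cd_def fg_def G_def E_def H_def field_simps power2_eq_square [of t])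
  have rel: "E 20 = G 10 * E 10" "E 10 = G 5 * E 5" "E 4 = G 2 * E 2" "G 1 = H 1 * G 2" "G 5 = H 5 * G 10"
      "E 5 = K 5 * E 10" "E 10 = K 10 * E 20"
    using E[of 10] E[of 5] E[of 2] G[of 1] G[of 5] K[of 5] K[of 10] by simp_all
  show "ramanujan_f t (t ^ 9) * ramanujan_f (t ^ 3) (t ^ 7) * (ramanujan_phi (- (t ^ 10)) * ramanujan_psi t)
       = ramanujan_f (t ^ 4) (t ^ 6) * ramanujan_f (t ^ 2) (t ^ 8) * (ramanujan_phi t * ramanujan_psi (- (t ^ 5)))"
  proof -
    have "cd * ((K 10 ^ 2 * E 20) * (H 1 * E 4)) = ab * ((H 1 ^ 2 * E 2) * (K 5 * E 20))"
    proof -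
      \<comment> \<open>Euler's identity between partitions into odd parts and into distinct parts;
        the next line uses it at level 5, with \<open>G 5\<close> split further.\<close>
      have K10: "K 10 = 1 / G 10" using rel(1,7) nz[of 10] by (simp add: field_simps)
      have K5: "K 5 = 1 / (H 5 * G 10)" using rel(2,5,6) nz[of 5] nz[of 10] by (simp add: field_simps)
      show ?thesis unfolding ab cd rel(1,3) K10 K5
        using nz[of 5] nz[of 10] by (simp add: field_simps power2_eq_square)
    qed
    thus ?thesis using phi[of 1] psi[of 1] phi'[of 10] psi'[of 5] by (simp add: ab_def cd_def)
  qed
  show "ramanujan_f t (t ^ 4) * ramanujan_f (t ^ 2) (t ^ 3) * ramanujan_psi (t ^ 5) ^ 2
       = ramanujan_f (t ^ 4) (t ^ 6) * ramanujan_f (t ^ 2) (t ^ 8)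
         * (ramanujan_f t (t ^ 9) * ramanujan_f (t ^ 3) (t ^ 7))"
  proof -
    have "fg * (H 5 * E 20) ^ 2 = ab * cd"
      unfolding ab cd fg rel(1,2,4,5) using nz[of 5] nz[of 10] by (simp add: field_simps power2_eq_square)
    thus ?thesis using psi[of 5] by (simp add: ab_def cd_def fg_def)
  qed
qed

theorem theorem3p4:
  fixes q \<Omega>\<^sub>1 \<Omega>\<^sub>2 :: complex
  assumes "0 < norm q" and "norm q < 1"
    and "\<Omega>\<^sub>1 = ramanujan_f (q ^ 4) (q ^ 6) / ramanujan_f (- q) (- (q ^ 9))"
    and "\<Omega>\<^sub>2 = q * (ramanujan_f (q ^ 2) (q ^ 8) / ramanujan_f (- (q ^ 3)) (- (q ^ 7)))"
  shows "1 / \<Omega>\<^sub>1 ^ 2 + 1 / \<Omega>\<^sub>2 ^ 2 =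
      ramanujan_phi (- q) ^ 4 / (16 * q ^ 4 * ramanujan_psi (- (q ^ 5)) ^ 4)
    + ramanujan_phi (- (q ^ 5)) ^ 4 / (16 * q ^ 4 * ramanujan_psi (- (q ^ 5)) ^ 4)
    - ramanujan_phi (- q) ^ 2 * ramanujan_phi (- (q ^ 5)) ^ 2
        / (8 * q ^ 4 * ramanujan_psi (- (q ^ 5)) ^ 4)
    + 2 * ramanujan_phi (- q) * ramanujan_psi (q ^ 5)
        / (q * ramanujan_phi (- (q ^ 10)) * ramanujan_psi (- q))"
proof -
  \<comment> \<open>All minus signs in the odd powers of \<open>q\<close> are absorbed; only the
    even power in \<open>- (t ^ 10)\<close> and the argument \<open>- (t ^ 5) = q ^ 5\<close> keep
    theirs.\<close>
  define t where "t = - q"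
  have t: "t \<noteq> 0" "norm t < 1" using assms by (auto simp: t_def)
  note lt = norm_power_less_1[OF t(2)]
  have q: "q = - t" by (simp add: t_def)
  define a b c d where "a = ramanujan_f (t ^ 4) (t ^ 6)" and "b = ramanujan_f (t ^ 2) (t ^ 8)"
    and "c = ramanujan_f t (t ^ 9)" and "d = ramanujan_f (t ^ 3) (t ^ 7)"
  define P P5 where "P = ramanujan_phi t" and "P5 = ramanujan_phi (t ^ 5)"
  define Q Q5 where "Q = ramanujan_psi t" and "Q5 = ramanujan_psi (t ^ 5)"
  define P10 R where "P10 = ramanujan_phi (- (t ^ 10))" and "R = ramanujan_psi (- (t ^ 5))"
  have nz: "a \<noteq> 0" "b \<noteq> 0" "c \<noteq> 0" "d \<noteq> 0" "Q \<noteq> 0" "Q5 \<noteq> 0" "P10 \<noteq> 0"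
    unfolding a_def b_def c_def d_def Q_def Q5_def P10_def ramanujan_phi_def ramanujan_psi_def
    using t by (simp_all add: ramanujan_f_nonzero lt flip: power_mult)
  have diff: "P ^ 2 - P5 ^ 2 = 4 * t * c * d"
    unfolding P_def P5_def c_def d_def by (rule phi_square_diff[OF t])
  have quot: "c * d * (P10 * Q) = a * b * (P * R)"
    unfolding a_def b_def c_def d_def P_def Q_def P10_def R_def by (rule quintic_theta_quotient[OF t])
  have split: "(a * d + t * b * c) * Q5 ^ 2 = a * b * (c * d)"
    using quintic_theta_quotient(2)[OF t] ramanujan_f_quintic_product[OF t]
    by (simp add: a_def b_def c_def d_def Q5_def)
  define X Y where "X = c / a" and "Y = d / (t * b)"
  have sum: "X + Y = c * d / (t * Q5 ^ 2)"
    using split nz t by (simp add: X_def Y_def field_simps)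
  have prod: "X * Y = P * R / (t * P10 * Q)"
    using quot nz t by (simp add: X_def Y_def field_simps)
  have "1 / \<Omega>\<^sub>1 ^ 2 + 1 / \<Omega>\<^sub>2 ^ 2 = X ^ 2 + Y ^ 2"
    unfolding assms(3,4) q by (simp add: X_def Y_def a_def b_def c_def d_def power_divide power_mult_distrib)
  also have "\<dots> = (X + Y) ^ 2 - 2 * (X * Y)"
    by (simp add: power2_eq_square algebra_simps)
  \<comment> \<open>By \<open>diff\<close>, \<open>c * d\<close> is
    \<open>(P ^ 2 - P5 ^ 2) / (4 * t)\<close>; with the further \<open>t\<close> in the denominator
    of \<open>sum\<close>, squaring produces \<open>16 * t ^ 4\<close>.\<close>
  also have "(X + Y) ^ 2 = (P ^ 2 - P5 ^ 2) ^ 2 / (16 * t ^ 4 * Q5 ^ 4)"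
    unfolding sum diff using nz t by (simp add: field_simps power2_eq_square eval_nat_numeral)
  also have "\<dots> = P ^ 4 / (16 * t ^ 4 * Q5 ^ 4) + P5 ^ 4 / (16 * t ^ 4 * Q5 ^ 4)
      - P ^ 2 * P5 ^ 2 / (8 * t ^ 4 * Q5 ^ 4)"
    using nz t by (simp add: field_simps power2_eq_square eval_nat_numeral)
  \<comment> \<open>The term \<open>- 2 * (X * Y)\<close> carries \<open>1 / t = - 1 / q\<close>,
    which turns it into the positive last term of the claim.\<close>
  finally show ?thesis
    unfolding prod q by (simp add: P_def P5_def Q_def Q5_def P10_def R_def)
qed

end
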